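(* Let $q$ be an odd prime power and let $d$ be an even positive integer. Assume that $q \equiv -1 \pmod d$, $q \equiv 1 \pmod 4$ and $\gcd\left(\frac{q+1}{d},d\right)=1$. Let $c \in \mathbb{F}_{q^2}$ be such that $\left(\frac{c}{2}\right)^{\frac{q+1}{2}} = 1$, let $r$ be a positive integer and let $k$ be an odd integer. Let $v=\frac{q+1}{d}$ and $v_1=(d-1)v$, and suppose that the exponents $v_1+k$ and $qv+k$ are nonnegative. Let $$h(x)=c+x^{v_1+k}+x^{qv+k}\in\mathbb{F}_{q^2}[x].$$ Let $s$ be a positive integer with $s \equiv \frac{q+1}{d} \pmod d$ and $s\le d$. Then $f(x)=x^r h(x^{q-1})$ is a permutation polynomial of $\mathbb{F}_{q^2}$ if and only if $\gcd\left(r-k,\frac{q+1}{d}\right)=1$, $\gcd(r,q-1)=1$ and $\gcd(s+r-k,d)=1$.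
   Context: $\mathbb{F}_{q^2}$ denotes the finite field with $q^2$ elements. A polynomial $f\in\mathbb{F}_{q^2}[x]$ is a permutation polynomial of $\mathbb{F}_{q^2}$ if the map $a\mapsto f(a)$ from $\mathbb{F}_{q^2}$ to itself is a bijection. *)

theory Defs
  imports
    "HOL-Library.Cardinality"
    "HOL-Computational_Algebra.Computational_Algebra"
    "HOL-Number_Theory.Cong"
    "HOL-Number_Theory.Prime_Powers"
begin

definition permutation_poly :: "'a::finite_field poly \<Rightarrow> bool" where
  "permutation_poly f \<longleftrightarrow> bij (poly f)"

end

theory Submission
  imports Defs "HOL-Number_Theory.Residues"
begin

text \<open>
  On the \<open>(q + 1)\<close>-st roots of unity both monomials of \<open>h\<close> equal \<open>y\<^bsup>k-v\<^esup>\<close>, so \<open>h(y) = 2 (e + t)\<close>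
  with \<open>e = c/2\<close> and \<open>t = y\<^bsup>k-v\<^esup>\<close> both of odd order dividing \<open>(q + 1)/2\<close>; in particular \<open>e \<noteq> -t\<close>.
  The Frobenius map inverts \<open>e\<close> and \<open>t\<close>, whence \<open>h(y)\<^bsup>q-1\<^esup> = 1/(e t)\<close>. Thus \<open>f\<close> induces
  the monomial map \<open>y \<mapsto> e\<^bsup>-1\<^esup> y\<^bsup>r+v-k\<^esup>\<close> on the \<open>(q + 1)\<close>-st roots of unity.
\<close>

section \<open>Coprime exponents in a field\<close>

text \<open>By Bezout, 1 is an integer combination of \<open>a\<close> and \<open>b\<close>, so
  \<open>z\<close> is a product of powers of \<open>z powi a\<close> and
  \<open>z powi b\<close>.\<close>

lemma eq_1_if_coprime_powers_eq_1:
  fixes z :: "'a::field"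
  assumes "z \<noteq> 0" "z powi a = 1" "z powi b = 1" "coprime a b"
  shows "z = 1"
proof -
  obtain u w where uw: "a * u + b * w = 1"
    using bezout_int[of a b] assms(4) by (metis coprime_imp_gcd_eq_1 mult.commute)
  have "z powi (a * u + b * w) = 1"
    using assms by (simp add: power_int_add power_int_mult)
  then show ?thesis
    by (simp add: uw)
qed

lemma eq_if_coprime_powers_eq:
  fixes x y :: "'a::field"
  assumes "x \<noteq> 0" "y \<noteq> 0" "x powi a = y powi a" "x powi b = y powi b" "coprime a b"
  shows "x = y"
  using eq_1_if_coprime_powers_eq_1[of "x / y" a b] assms
  by (simp add: power_int_divide_distrib)

section \<open>Roots of unity in a finite field\<close>

lemma finite_field_power_card_minus_1:
  fixes x :: "'a::finite_field"
  assumes "x \<noteq> 0"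
  shows "x ^ (CARD('a) - 1) = 1"
proof -
  have "x * x ^ (CARD('a) - 1) = x"
    using finite_field_power_card_eq_same[of x]
    by (metis finite_UNIV_card_ge_0 finite power_minus_mult mult.commute)
  with assms show ?thesis
    by simp
qed

text \<open>Otherwise all nonzero elements would be roots of a polynomial of degree
  \<open>m\<close>, which is too small.\<close>

lemma finite_field_ex_power_neq_1:
  fixes m :: nat
  assumes "0 < m" "m < CARD('a::finite_field) - 1"
  shows "\<exists>y::'a. y \<noteq> 0 \<and> y ^ m \<noteq> 1"
proof (rule ccontr)
  assume *: "\<not> ?thesis"
  define p :: "'a poly" where "p = Polynomial.monom 1 m - 1"
  have poly_p: "poly p y = y ^ m - 1" for y
    by (simp add: p_def poly_monom)
  have deg: "degree p = m"
    unfolding p_def using assms(1)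
    by (simp add: degree_monom_eq degree_add_eq_left diff_conv_add_uminus del: add_uminus_conv_diff)
  then have "p \<noteq> 0"
    using assms(1) by auto
  have "UNIV - {0} \<subseteq> {y. poly p y = 0}"
    using * by (auto simp: poly_p)
  then have "card (UNIV - {0::'a}) \<le> card {y. poly p y = 0}"
    by (intro card_mono) auto
  also have "\<dots> \<le> m"
    using card_poly_roots_bound[OF \<open>p \<noteq> 0\<close>] deg by simp
  finally show False
    using assms(2) by (simp add: card_Diff_singleton)
qed

text \<open>Supplies nontrivial roots of unity for both necessity arguments below. The root is
  exhibited as an \<open>l\<close>-th power, so that for a composite \<open>l\<close> it is visibly
  an \<open>m\<close>-th power as well.\<close>

lemma finite_field_ex_root_of_unity:
  fixes l n :: nat
  assumes "CARD('a::finite_field) - 1 = l * n" "1 < n"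
  shows "\<exists>y::'a. y \<noteq> 0 \<and> y ^ l \<noteq> 1 \<and> (y ^ l) ^ n = 1"
proof -
  have "card {0, 1 :: 'a} \<le> CARD('a)"
    by (rule card_mono) auto
  then have "0 < CARD('a) - 1"
    by simp
  then have "0 < l"
    unfolding assms(1) by simp
  then have "l < CARD('a) - 1"
    unfolding assms(1) using assms(2) by simp
  then obtain y :: 'a where "y \<noteq> 0" "y ^ l \<noteq> 1"
    using finite_field_ex_power_neq_1[OF \<open>0 < l\<close>] by auto
  moreover have "(y ^ l) ^ n = 1"
    using finite_field_power_card_minus_1[OF \<open>y \<noteq> 0\<close>] unfolding assms(1) power_mult .
  ultimately show ?thesis
    by blast
qed

section \<open>Permutation criterion for maps \<open>x ^ r * H (x ^ m)\<close>\<close>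

text \<open>
  The power map \<open>x \<mapsto> x\<^sup>m\<close> semiconjugates \<open>F\<close> to \<open>y \<mapsto> a y\<^sup>N\<close> on the \<open>n\<close>-th roots of unity,
  and on each of its fibres \<open>F\<close> is a constant multiple of \<open>x\<^sup>r\<close>.
\<close>

lemma bij_times_power_of_power_iff:
  fixes F H :: "'a::finite_field \<Rightarrow> 'a" and a :: 'a and m n r :: nat and N :: int
  assumes card: "CARD('a) - 1 = m * n"
    and "r > 0"
    and F: "\<And>x. F x = x ^ r * H (x ^ m)"
    and H_nz: "\<And>y. y ^ n = 1 \<Longrightarrow> H y \<noteq> 0"
    and "a \<noteq> 0"
    and H_power: "\<And>y. y ^ n = 1 \<Longrightarrow> y ^ r * H y ^ m = a * y powi N"
  shows "bij F \<longleftrightarrow> coprime r m \<and> coprime N (int n)"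
proof -
  have "card {0, 1 :: 'a} \<le> CARD('a)"
    by (rule card_mono) auto
  then have "m * n > 0"
    unfolding card[symmetric] by simp
  then have mn: "m > 0" "n > 0"
    by auto
  have unity: "(x ^ m) ^ n = 1" if "x \<noteq> 0" for x :: 'a
    using finite_field_power_card_minus_1[OF that] unfolding card power_mult .
  have F_0 [simp]: "F 0 = 0"
    using \<open>r > 0\<close> F by simp
  have F_nz: "F x \<noteq> 0" if "x \<noteq> 0" for x
    using H_nz[OF unity[OF that]] that F by simp
  have F_power: "F x ^ m = a * (x ^ m) powi N" if "x \<noteq> 0" for x
  proof -
    have "F x ^ m = (x ^ m) ^ r * H (x ^ m) ^ m"
      by (simp add: F power_mult_distrib flip: power_mult) (simp add: mult.commute)
    then show ?thesis
      using H_power[OF unity[OF that]] by simp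
  qed
  show ?thesis
  proof
    assume "coprime r m \<and> coprime N (int n)"
    then have cop: "coprime (int r) (int m)" "coprime N (int n)"
      by simp_all
    have "inj F"
    proof (rule injI)
      fix x y assume eq: "F x = F y"
      show "x = y"
      proof (cases "x = 0 \<or> y = 0")
        case True
        then show ?thesis
          using eq F_nz F_0 by metis
      next
        case False
        then have nz: "x \<noteq> 0" "y \<noteq> 0"
          by auto
        \<comment> \<open>First recover \<open>x ^ m\<close>, from its \<open>N\<close>-th power and
          its \<open>n\<close>-th power 1; then \<open>H\<close> cancels, and \<open>x\<close> is
          recovered from its \<open>r\<close>-th and \<open>m\<close>-th powers.\<close>
        have "(x ^ m) powi N = (y ^ m) powi N"
          using F_power[OF nz(1)] F_power[OF nz(2)] eq \<open>a \<noteq> 0\<close> by simp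
        then have m_eq: "x ^ m = y ^ m"
          using eq_if_coprime_powers_eq[of "x ^ m" "y ^ m" N "int n"] unity nz cop by simp
        then have "x ^ r = y ^ r"
          using eq H_nz[OF unity[OF nz(2)]] by (simp add: F)
        then show ?thesis
          using eq_if_coprime_powers_eq[of x y "int r" "int m"] nz cop m_eq by simp
      qed
    qed
    then show "bij F"
      by (simp add: bij_def finite_UNIV_inj_surj)
  next
    assume "bij F"
    then have "inj F"
      by (rule bij_is_inj)
    have r_m: "coprime r m"
    proof (rule ccontr)
      assume "\<not> coprime r m"
      define g where "g = gcd r m"
      have "g \<noteq> 0"
        using \<open>r > 0\<close> by (simp add: g_def)
      with \<open>\<not> coprime r m\<close> have "1 < g"
        unfolding g_def coprime_iff_gcd_eq_1 by linarith
      obtain l where l: "m = g * l"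
        unfolding g_def by (meson gcd_dvd2 dvdE)
      obtain j where j: "r = g * j"
        unfolding g_def by (meson gcd_dvd1 dvdE)
      \<comment> \<open>A nontrivial \<open>g\<close>-th root of unity is killed by both exponents
        \<open>r\<close> and \<open>m\<close>, so \<open>F\<close> cannot tell it from 1.\<close>
      obtain y :: 'a where y: "y \<noteq> 0" "y ^ (l * n) \<noteq> 1" "(y ^ (l * n)) ^ g = 1"
        using finite_field_ex_root_of_unity[where 'a = 'a, of "l * n" g] card l \<open>1 < g\<close>
        by (auto simp: mult_ac)
      define z where "z = y ^ (l * n)"
      have "z ^ r = 1" "z ^ m = 1"
        using y(3) by (simp_all add: z_def l j power_mult)
      then have "F z = F 1"
        by (simp add: F)
      with \<open>inj F\<close> have "z = 1"
        by (rule injD)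
      with y(2) show False
        by (simp add: z_def)
    qed
    moreover have "coprime N (int n)"
    proof (rule ccontr)
      assume ncop: "\<not> coprime N (int n)"
      define g where "g = nat (gcd N (int n))"
      have g: "int g = gcd N (int n)"
        by (simp add: g_def)
      have "g \<noteq> 0" "g \<noteq> 1"
        using mn ncop g unfolding coprime_iff_gcd_eq_1 by (auto intro!: Nat.gr0I)
      then have "1 < g"
        by simp
      have "int g dvd int n"
        by (simp add: g)
      then obtain l where l: "n = g * l"
        by (auto simp: int_dvd_int_iff elim: dvdE)
      have "int g dvd N"
        by (simp add: g)
      then obtain j where j: "N = int g * j"
        by (elim dvdE)
      \<comment> \<open>This yields \<open>z\<close> such that \<open>z ^ m\<close> is a nontrivial
        \<open>g\<close>-th root of unity; since \<open>g\<close> divides \<open>N\<close>, the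
        induced map sends \<open>z ^ m\<close> and 1 to the same value.\<close>
      obtain y :: 'a where y: "y \<noteq> 0" "y ^ (m * l) \<noteq> 1" "(y ^ (m * l)) ^ g = 1"
        using finite_field_ex_root_of_unity[where 'a = 'a, of "m * l" g] card l \<open>1 < g\<close>
        by (auto simp: mult_ac)
      define z where "z = y ^ l"
      have z: "z \<noteq> 0" "z ^ m \<noteq> 1" "(z ^ m) ^ g = 1"
        using y by (simp_all add: z_def mult.commute flip: power_mult)
      have "(z ^ m) powi N = 1"
        unfolding j by (subst power_int_mult) (use z(3) in simp)
      then have "F z ^ m = F 1 ^ m"
        using F_power[of z] F_power[of 1] z(1) by simp
      \<comment> \<open>\<open>F z\<close> and \<open>F 1\<close> differ by an \<open>m\<close>-th
        root of unity \<open>u\<close>. As \<open>r\<close> is coprime to \<open>m\<close>,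
        \<open>u\<close> is the \<open>r\<close>-th power of another one, \<open>t\<close>, so
        \<open>F t = t ^ r * F 1 = F z\<close> although \<open>t\<close> and \<open>z\<close> have
        different \<open>m\<close>-th powers.\<close>
      define u where "u = F z / F 1"
      have u: "u \<noteq> 0" "u ^ m = 1"
        using \<open>F z ^ m = F 1 ^ m\<close> F_nz[of 1] F_nz[of z] z(1) by (simp_all add: u_def power_divide)
      obtain i w :: int where iw: "int r * i + int m * w = 1"
        using bezout_int[of "int r" "int m"] r_m
        by (metis coprime_imp_gcd_eq_1 coprime_int_iff mult.commute)
      define t where "t = u powi i"
      have "t ^ m = 1"
        using u power_int_power'[of u i m] power_int_power[of u m i]
        by (simp add: t_def mult.commute)
      have "u = u powi (int r * i + int m * w)"
        by (simp add: iw)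
      also have "\<dots> = t ^ r"
        using u power_int_power'[of u i r] power_int_mult[of u "int m" w]
        by (simp add: t_def power_int_add mult.commute)
      finally have "F t = F z"
        using F[of t] F[of 1] \<open>t ^ m = 1\<close> F_nz[of 1] by (simp add: u_def field_simps)
      then have "t = z"
        using \<open>inj F\<close> by (simp add: injD)
      with \<open>t ^ m = 1\<close> z(2) show False
        by simp
    qed
    ultimately show "coprime r m \<and> coprime N (int n)"
      by simp
  qed
qed

section \<open>The trinomial over the field with \<open>q\<^sup>2\<close> elements\<close>

text \<open>Makes the \<open>q\<close>-th power map additive: the characteristic divides a power of
  the prime below \<open>q\<close>, hence equals that prime.\<close>

lemma finite_field_card_power_CHAR:
  assumes "primepow q" "CARD('a::finite_field) = q ^ k"
  shows "\<exists>j>0. q = CHAR('a) ^ j"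
proof -
  obtain p j where pj: "prime p" "j > 0" "q = p ^ j"
    using assms(1) by (auto simp: primepow_def)
  have "CHAR('a) dvd (p ^ j) ^ k"
    using CHAR_dvd_CARD[where 'a = 'a] unfolding assms(2) pj(3) .
  then have "CHAR('a) dvd p"
    by (auto dest!: prime_dvd_power[OF CHAR_prime])
  then have "CHAR('a) = p"
    using pj(1) by (intro primes_dvd_imp_eq) auto
  with pj show ?thesis
    by blast
qed

theorem theorem1p1:
  fixes q d r s v v1 :: nat
    and k :: int
    and c :: "'a::finite_field"
    and h f :: "'a poly"
  assumes "primepow q" and "odd q"
    and card: "CARD('a) = q\<^sup>2"
    and "d > 0" and "even d"
    and "[int q = -1] (mod int d)"
    and "[q = 1] (mod 4)"
    and "gcd ((q + 1) div d) d = 1"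
    and "(c / 2) ^ ((q + 1) div 2) = 1"
    and "r > 0" and "odd k"
    and "v = (q + 1) div d" and "v1 = (d - 1) * v"
    and "int v1 + k \<ge> 0" and "int (q * v) + k \<ge> 0"
    and h: "h = [:c:] + Polynomial.monom 1 (nat (int v1 + k)) + Polynomial.monom 1 (nat (int (q * v) + k))"
    and "s > 0" and "[s = (q + 1) div d] (mod d)" and "s \<le> d"
    and f: "f = Polynomial.monom 1 r * pcompose h (Polynomial.monom 1 (q - 1))"
  shows "permutation_poly f \<longleftrightarrow>
    gcd (int r - k) (int ((q + 1) div d)) = 1 \<and>
    gcd r (q - 1) = 1 \<and>
    gcd (int s + int r - k) (int d) = 1"
proof -
  define e where "e = c / 2"
  define M where "M = (q + 1) div 2"
  define N where "N = int r + (int v - k)"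
  obtain j where j: "q = CHAR('a) ^ j"
    using finite_field_card_power_CHAR[OF assms(1) card] by blast
  have frobenius: "(x + y) ^ q = x ^ q + y ^ q" for x y :: 'a
    by (rule freshmans_dream'[OF CHAR_prime j])
  have "q > 1"
    using assms(1) by (simp add: primepow_gt_Suc_0)
  have two_nz: "(2::'a) \<noteq> 0"
  proof
    assume "(2::'a) = 0"
    then have "of_nat 2 = (0::'a)"
      by simp
    then have "CHAR('a) dvd 2"
      by (simp only: of_nat_eq_0_iff_char_dvd)
    then have "CHAR('a) = 2"
      by (simp add: primes_dvd_imp_eq)
    moreover have "j \<noteq> 0"
      using j \<open>q > 1\<close> by (cases j) auto
    ultimately show False
      using j \<open>odd q\<close> by simp
  qed
  \<comment> \<open>Oddness of \<open>M\<close> gives \<open>(-1) ^ M = -1\<close>, which later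
    rules out \<open>e = -t\<close>.\<close>
  have M: "q + 1 = 2 * M" "odd M"
  proof -
    obtain i where "q - 1 = 4 * i"
      using cong_to_1_nat[OF \<open>[q = 1] (mod 4)\<close>] by (elim dvdE)
    then have "q = 4 * i + 1"
      using \<open>q > 1\<close> by linarith
    then show "q + 1 = 2 * M" "odd M"
      by (simp_all add: M_def)
  qed
  have "d dvd q + 1"
  proof -
    have "int d dvd int q - (- 1)"
      using assms(6) by (simp add: cong_iff_dvd_diff)
    then have "int d dvd int (q + 1)"
      by (simp add: add.commute)
    then show ?thesis
      by (simp only: int_dvd_int_iff)
  qed
  then have dv: "q + 1 = d * v"
    by (simp add: \<open>v = _\<close>)
  have "coprime v d"
    using assms(8) by (simp add: \<open>v = _\<close> coprime_iff_gcd_eq_1)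
  then have "odd v"
    using \<open>even d\<close> coprime_common_divisor[of v d 2] by auto
  have e_M: "e ^ M = 1"
    using assms(9) by (simp add: e_def M_def)
  have "M > 0"
    using M(2) by (cases M) auto
  have "e \<noteq> 0"
    using e_M \<open>M > 0\<close> by (auto simp: power_0_left)
  have inv_q: "x ^ q = inverse x" if "x ^ M = 1" for x :: 'a
  proof -
    have "x ^ (q + 1) = (x ^ M) ^ 2"
      unfolding M(1) by (simp add: mult.commute flip: power_mult)
    with that show ?thesis
      by (intro inverse_unique[symmetric]) simp
  qed
  let ?H = "poly h"
  have H: "?H y = 2 * (e + y powi (k - int v))" "(y powi (k - int v)) ^ M = 1" "y \<noteq> 0"
    if y: "y ^ (q + 1) = 1" for y
  proof -
    show "y \<noteq> 0"
      using y by auto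
    \<comment> \<open>Exponents of \<open>y\<close> matter only modulo \<open>q + 1\<close>, and
      both exponents in \<open>h\<close> are congruent to \<open>k - v\<close>.\<close>
    have shift: "y ^ nat i = y powi (k - int v)" if "i \<ge> 0" "i = k - int v + int (q + 1) * l" for i l
    proof -
      have "y ^ nat i = y powi i"
        using that(1) by (simp add: power_int_nonneg_exp)
      also have "\<dots> = y powi (k - int v) * (y powi int (q + 1)) powi l"
        unfolding that(2) using \<open>y \<noteq> 0\<close> by (simp only: power_int_add power_int_mult simp_thms)
      finally show ?thesis
        using y by (simp only: power_int_of_nat power_int_1_left mult_1_right)
    qed
    have "int v1 = int (q + 1) - int v"
      unfolding dv \<open>v1 = _\<close> using \<open>d > 0\<close> by (cases d) (simp_all add: algebra_simps)
    then have 1: "y ^ nat (int v1 + k) = y powi (k - int v)"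
      by (intro shift[where l = 1]) (use assms(14) in auto)
    have 2: "y ^ nat (int (q * v) + k) = y powi (k - int v)"
      by (intro shift[where l = "int v"]) (use assms(15) in \<open>auto simp: algebra_simps\<close>)
    show "?H y = 2 * (e + y powi (k - int v))"
      using two_nz unfolding h poly_add poly_monom 1 2 e_def by (simp add: field_simps)
    \<comment> \<open>Evenness makes \<open>y powi (k - int v)\<close> a power of
      \<open>y ^ 2\<close>, whose \<open>M\<close>-th power is
      \<open>y ^ (q + 1) = 1\<close>.\<close>
    have "even (k - int v)"
      using \<open>odd k\<close> \<open>odd v\<close> by simp
    then obtain l where l: "k - int v = 2 * l"
      by (elim dvdE)
    have "(y powi (k - int v)) ^ M = (y powi int (q + 1)) powi l"
      unfolding M(1) l by (simp add: power_int_power' mult_ac flip: power_int_mult)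
    then show "(y powi (k - int v)) ^ M = 1"
      using y by (simp only: power_int_of_nat power_int_1_left)
  qed
  have H_nz: "?H y \<noteq> 0" if y: "y ^ (q + 1) = 1" for y
  proof
    let ?t = "y powi (k - int v)"
    assume "?H y = 0"
    then have "e = - ?t"
      using H(1)[OF y] two_nz by (simp add: eq_neg_iff_add_eq_0 del: distrib_left_numeral)
    then have "e ^ M = - (?t ^ M)"
      using M(2) by simp
    then have "(1::'a) = -1"
      using e_M H(2)[OF y] by simp
    with two_nz show False
      by (simp add: eq_neg_iff_add_eq_0)
  qed
  have H_power: "y ^ r * ?H y ^ (q - 1) = inverse e * y powi N" if y: "y ^ (q + 1) = 1" for y
  proof -
    define t where "t = y powi (k - int v)"
    have "t \<noteq> 0"
      using H(3)[OF y] by (simp add: t_def)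
    have "?H y ^ (q - 1) * ?H y = ?H y ^ q"
      using \<open>q > 1\<close> by (intro power_minus_mult) simp
    also have "\<dots> = 2 ^ q * (e + t) ^ q"
      unfolding H(1)[OF y] t_def by (rule power_mult_distrib)
    \<comment> \<open>2 = 1 + 1 lies in the prime field, which Frobenius fixes.\<close>
    also have "(2::'a) ^ q = 2"
      using frobenius[of 1 1] by simp
    also have "(e + t) ^ q = inverse e + inverse t"
      using inv_q e_M H(2)[OF y] by (simp add: frobenius t_def)
    \<comment> \<open>From 1/e + 1/t = (e + t)/(e t), the value of \<open>h\<close> reappears and
      can be cancelled.\<close>
    also have "2 * (inverse e + inverse t) = inverse e * inverse t * ?H y"
      using \<open>e \<noteq> 0\<close> \<open>t \<noteq> 0\<close> unfolding H(1)[OF y] t_def[symmetric] by (simp add: field_simps)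
    finally have "?H y ^ (q - 1) = inverse e * inverse t"
      using H_nz[OF y] by simp
    also have "inverse t = y powi (int v - k)"
      by (simp add: t_def flip: power_int_minus)
    finally show ?thesis
      using H(3)[OF y] by (simp add: N_def power_int_add)
  qed
  have "CARD('a) - 1 = (q - 1) * (q + 1)"
    using \<open>q > 1\<close> unfolding card by (simp add: algebra_simps power2_eq_square)
  moreover have "poly f x = x ^ r * ?H (x ^ (q - 1))" for x
    by (simp add: f poly_monom poly_pcompose)
  ultimately have "bij (poly f) \<longleftrightarrow> coprime r (q - 1) \<and> coprime N (int (q + 1))"
    using \<open>r > 0\<close> H_nz H_power \<open>e \<noteq> 0\<close>
    by (intro bij_times_power_of_power_iff[where H = ?H and a = "inverse e"]) auto
  \<comment> \<open>The condition splits along \<open>q + 1 = d * v\<close>: modulo \<open>v\<close>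
    the summand \<open>v\<close> of \<open>N\<close> vanishes, modulo \<open>d\<close> it becomes
    \<open>s\<close>.\<close>
  moreover have "coprime N (int (q + 1)) \<longleftrightarrow> coprime N (int d) \<and> coprime N (int v)"
    unfolding dv by simp
  moreover have "coprime N (int v) \<longleftrightarrow> coprime (int r - k) (int v)"
  proof -
    have "[N = int r - k] (mod int v)"
      by (simp add: N_def cong_iff_dvd_diff)
    then show ?thesis
      by (rule coprime_cong_cong_left)
  qed
  moreover have "coprime N (int d) \<longleftrightarrow> coprime (int s + int r - k) (int d)"
  proof -
    have "[int v = int s] (mod int d)"
      using assms(18) by (simp add: \<open>v = _\<close> cong_int_iff cong_sym_eq)
    then have "[N = int s + int r - k] (mod int d)"
      by (simp add: N_def cong_iff_dvd_diff algebra_simps)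
    then show ?thesis
      by (rule coprime_cong_cong_left)
  qed
  ultimately show ?thesis
    unfolding permutation_poly_def \<open>v = _\<close> coprime_iff_gcd_eq_1 by (simp only: conj_ac)
qed

end
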